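(* Let $\mu,\mu'$ be probability measures on $\mathbb Z$ with supports $S_\mu,S_{\mu'}$ such that the four sets $S_\mu\cap\mathbb Z^+$, $S_\mu\cap\mathbb Z^-$, $S_{\mu'}\cap\mathbb Z^+$, $S_{\mu'}\cap\mathbb Z^-$ are all non-empty. Let $\mathcal X^{(0)}=\mathcal X^{(0)}(\mu,\mu')$ be the associated oscillating random walk, let $\delta=d\wedge d'$ be the greatest common divisor of $d$ and $d'$, and assume $d\ne d'$. (1) Case $D<d'$. (i) If $x\in\{D,\ldots,d'-1\}+d'\mathbb Z_0^+$, then $x$ is transient and its irreducible class is $\mathcal I(x)=(x+d'\mathbb Z)\cap[D,+\infty[$. (ii) Otherwise, $x$ is essential and its essential class is $\mathcal I(x)=(r_x+\delta\mathbb Z)\setminus(\{D,\ldots,d'-1\}+d'\mathbb Z_0^+)$. (2) Case $D'>-d$. (i) If $x\in\{-d,\ldots,D'-1\}+d\,\mathbb Z_0^-$, then $x$ is transient and its irreducible class is $\mathcal I(x)=(x+d\mathbb Z)\cap\,]-\infty,D'-1]$. (ii) Otherwise, $x$ is essential and its essential class is $\mathcal I(x)=(r_x+\delta\mathbb Z)\setminus(\{-d,\ldots,D'-1\}+d\,\mathbb Z_0^-)$. (3) Case $D\ge d'$ and $D'\le-d$. There are $\delta$ irreducible classes, which are all essential: $r+\delta\mathbb Z$ with $0\le r<\delta$.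
   Context: $\mathbb Z^+$ (resp. $\mathbb Z^-$) is the set of positive (resp. negative) integers; $\mathbb Z_0^\pm=\mathbb Z^\pm\cup\{0\}$. $D=\max S_\mu$ (with $D=+\infty$ if $S_\mu$ is unbounded above), $D'=\min S_{\mu'}$ (with $D'=-\infty$ if $S_{\mu'}$ is unbounded below), $d=\gcd(S_\mu)$, $d'=\gcd(S_{\mu'})$. For $x\in\mathbb Z$, $r_x$ is the remainder of $x$ in the Euclidean division by $\delta$, $0\le r_x<\delta$. Sums of sets are Minkowski sums. The chain $\mathcal X^{(0)}(\mu,\mu')=(X_n^{(0)})_{n\ge0}$ is the Markov chain on $\mathbb Z$ with $X_{n+1}^{(0)}=X_n^{(0)}+\xi_{n+1}$ if $X_n^{(0)}\le-1$ and $X_{n+1}^{(0)}=X_n^{(0)}+\xi'_{n+1}$ if $X_n^{(0)}\ge0$, where $(\xi_n,\xi_n')_{n\ge1}$ is i.i.d., $\xi_n$ has law $\mu$ and $\xi'_n$ has law $\mu'$. Write $x\to y$ if $\mathbb P_x[X_n^{(0)}=y]>0$ for some $n\ge0$. The irreducible class $\mathcal I(x)$ of $x$ is the set of $y$ with $x\to y$ and $y\to x$. The relation $\to$ induces a partial order on irreducible classes; the maximal (i.e. closed) classes, and their points, are called essential; the non-essential classes, and their points, are called transient. *)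

theory Defs
  imports "HOL-Probability.Probability" "HOL-Library.Set_Algebras"
begin

(* The pairs (xi n, xi' n), n >= 1, are i.i.d. with marginals mu and mu'.  The two
   components of one pair may depend on each other in an arbitrary way. *)
locale oscillating_steps = prob_space M
  for M :: "'w measure" and \<mu> \<mu>' :: "int pmf" and \<xi> \<xi>' :: "nat \<Rightarrow> 'w \<Rightarrow> int" +
  assumes indep_pairs:
      "indep_vars (\<lambda>_. count_space UNIV) (\<lambda>n \<omega>. (\<xi> n \<omega>, \<xi>' n \<omega>)) {1..}"
    and identically_distributed_pairs:
      "\<And>m n. m \<ge> 1 \<Longrightarrow> n \<ge> 1 \<Longrightarrow>
         distr M (count_space UNIV) (\<lambda>\<omega>. (\<xi> m \<omega>, \<xi>' m \<omega>))
         = distr M (count_space UNIV) (\<lambda>\<omega>. (\<xi> n \<omega>, \<xi>' n \<omega>))"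
    and distr_xi: "\<And>n. n \<ge> 1 \<Longrightarrow> distr M (count_space UNIV) (\<xi> n) = measure_pmf \<mu>"
    and distr_xi': "\<And>n. n \<ge> 1 \<Longrightarrow> distr M (count_space UNIV) (\<xi>' n) = measure_pmf \<mu>'"

primrec osc_walk ::
  "(nat \<Rightarrow> 'w \<Rightarrow> int) \<Rightarrow> (nat \<Rightarrow> 'w \<Rightarrow> int) \<Rightarrow> int \<Rightarrow> nat \<Rightarrow> 'w \<Rightarrow> int" where
  "osc_walk \<xi> \<xi>' x 0 \<omega> = x"
| "osc_walk \<xi> \<xi>' x (Suc n) \<omega> =
     (if osc_walk \<xi> \<xi>' x n \<omega> \<le> -1
      then osc_walk \<xi> \<xi>' x n \<omega> + \<xi> (Suc n) \<omega>
      else osc_walk \<xi> \<xi>' x n \<omega> + \<xi>' (Suc n) \<omega>)"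

definition leads_to ::
  "'w measure \<Rightarrow> (nat \<Rightarrow> 'w \<Rightarrow> int) \<Rightarrow> (nat \<Rightarrow> 'w \<Rightarrow> int) \<Rightarrow> int \<Rightarrow> int \<Rightarrow> bool" where
  "leads_to M \<xi> \<xi>' x y \<longleftrightarrow>
     (\<exists>n. measure M {\<omega> \<in> space M. osc_walk \<xi> \<xi>' x n \<omega> = y} > 0)"

definition irr_class :: "('s \<Rightarrow> 's \<Rightarrow> bool) \<Rightarrow> 's \<Rightarrow> 's set" where
  "irr_class R x = {y. R x y \<and> R y x}"

definition irr_classes :: "('s \<Rightarrow> 's \<Rightarrow> bool) \<Rightarrow> 's set set" where
  "irr_classes R = range (irr_class R)"

definition class_le :: "('s \<Rightarrow> 's \<Rightarrow> bool) \<Rightarrow> 's set \<Rightarrow> 's set \<Rightarrow> bool" where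
  "class_le R C C' \<longleftrightarrow> (\<exists>x\<in>C. \<exists>y\<in>C'. R x y)"

definition essential_class :: "('s \<Rightarrow> 's \<Rightarrow> bool) \<Rightarrow> 's set \<Rightarrow> bool" where
  "essential_class R C \<longleftrightarrow>
     C \<in> irr_classes R \<and> (\<forall>C'\<in>irr_classes R. class_le R C C' \<longrightarrow> C' = C)"

definition essential :: "('s \<Rightarrow> 's \<Rightarrow> bool) \<Rightarrow> 's \<Rightarrow> bool" where
  "essential R x \<longleftrightarrow> essential_class R (irr_class R x)"

(* "Transient" means non-essential here, not almost surely finitely many visits. *)
definition transient :: "('s \<Rightarrow> 's \<Rightarrow> bool) \<Rightarrow> 's \<Rightarrow> bool" where
  "transient R x \<longleftrightarrow> \<not> essential R x"

(* On int, Sup (Inf) of a non-empty set bounded above (below) is its maximum (minimum). *)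
definition ext_max :: "int set \<Rightarrow> ereal" where
  "ext_max S = (if bdd_above S then ereal (of_int (Sup S)) else \<infinity>)"

definition ext_min :: "int set \<Rightarrow> ereal" where
  "ext_min S = (if bdd_below S then ereal (of_int (Inf S)) else - \<infinity>)"

end

(* Almost surely every increment lies in its support, and each finite path with increments
   in the supports has positive probability by independence; so the relation x -> y is
   reachability in a graph on the integers.  Inside one half-line a walk may make all its
   positive jumps before its negative ones, hence from x >= 0 it reaches every y >= 0 with
   y = x mod d' (and even every y >= -d'), and similarly below 0 with d.  Suppose d <= d'.
   From z < 0 the walk reaches z mod d in {0..d-1} and from there z mod d - d' < 0; iterating,
   it reaches every negative point congruent to z modulo gcd d d'.  A jump from the negative
   side lands below D, so the nonnegative points reached are those with y mod d' < D.  The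
   remaining case follows from the reflection x -> -1 - x, which replaces (S, S') by (-S', -S). *)
theory Submission
  imports Defs "HOL-Computational_Algebra.Group_Closure"
begin

section \<open>Splitting multiples of the gcd into upward and downward jumps\<close>

inductive_set nonneg_sums :: "int set \<Rightarrow> int set" for A where
  zero: "0 \<in> nonneg_sums A"
| add: "a \<in> A \<Longrightarrow> b \<in> nonneg_sums A \<Longrightarrow> a + b \<in> nonneg_sums A"

lemma nonneg_sums_add:
  "a \<in> nonneg_sums A \<Longrightarrow> b \<in> nonneg_sums A \<Longrightarrow> a + b \<in> nonneg_sums A"
  by (induction rule: nonneg_sums.induct) (auto simp: add.assoc intro: nonneg_sums.add)

lemma nonneg_sums_of_nat_mult: "a \<in> A \<Longrightarrow> int k * a \<in> nonneg_sums A"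
  by (induction k) (auto simp: algebra_simps intro: nonneg_sums.intros)

definition two_sided :: "int set \<Rightarrow> bool" where
  "two_sided A \<longleftrightarrow> A \<inter> {0<..} \<noteq> {} \<and> A \<inter> {..<0} \<noteq> {}"

text \<open>The sums \<open>u + v\<close> form a set \<open>G\<close> closed under addition and,
  because jumps of both signs exist, under negation. So \<open>G\<close> is a group containing
  \<open>A\<close> and hence contains every multiple of \<open>Gcd A\<close>. Separating the signs
  lets a walk make all upward jumps first.\<close>

lemma up_down_decomposition:
  assumes "two_sided A" "Gcd A dvd z"
  obtains u v where "u \<in> nonneg_sums (A \<inter> {0<..})" "v \<in> nonneg_sums (A \<inter> {..<0})" "z = u + v"
proof -
  let ?U = "nonneg_sums (A \<inter> {0<..})" and ?V = "nonneg_sums (A \<inter> {..<0})"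
  define G where "G = {u + v |u v. u \<in> ?U \<and> v \<in> ?V}"
  obtain p n where p: "p \<in> A" "p > 0" and n: "n \<in> A" "n < 0"
    using assms(1) unfolding two_sided_def by blast
  have G_add: "a + b \<in> G" if ab: "a \<in> G" "b \<in> G" for a b
  proof -
    obtain u v u' v' where uv: "u \<in> ?U" "v \<in> ?V" "u' \<in> ?U" "v' \<in> ?V" "a = u + v" "b = u' + v'"
      using ab unfolding G_def by auto
    then have "a + b = (u + u') + (v + v')" by simp
    then show ?thesis
      unfolding G_def using uv nonneg_sums_add by blast
  qed
  have G_U: "u \<in> G" if "u \<in> ?U" for u
    using that nonneg_sums.zero unfolding G_def by force
  have G_V: "v \<in> G" if "v \<in> ?V" for v
    using that nonneg_sums.zero unfolding G_def by force
  have mult_pos: "int k * a \<in> G" if "a \<in> A" "a > 0" for k a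
    using that by (intro G_U nonneg_sums_of_nat_mult) auto
  have mult_neg: "int k * a \<in> G" if "a \<in> A" "a < 0" for k a
    using that by (intro G_V nonneg_sums_of_nat_mult) auto
  have minus_pos: "- a \<in> G" if a: "a \<in> A" "a > 0" for a
  proof -
    \<comment> \<open>Here \<open>- a\<close> is written as \<open>- n - 1\<close> copies of
      \<open>a\<close> plus \<open>a\<close> copies of \<open>n\<close>; as
      \<open>n \<le> - 1\<close>, both numbers of copies are nonnegative.\<close>
    have "int (nat (- n - 1)) * a + int (nat a) * n \<in> G"
      by (intro G_add mult_pos mult_neg a n)
    moreover have "int (nat (- n - 1)) * a + int (nat a) * n = - a"
      using a n by (simp add: algebra_simps)
    ultimately show ?thesis by simp
  qed
  have minus_neg: "- a \<in> G" if a: "a \<in> A" "a < 0" for a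
  proof -
    have "int (nat (p - 1)) * a + int (nat (- a)) * p \<in> G"
      by (intro G_add mult_pos mult_neg a p)
    moreover have "int (nat (p - 1)) * a + int (nat (- a)) * p = - a"
      using a p by (simp add: algebra_simps)
    ultimately show ?thesis by simp
  qed
  have zero: "0 \<in> G" using G_U nonneg_sums.zero by blast
  have minus_U: "- u \<in> G" if "u \<in> ?U" for u
    using that
  proof (induction rule: nonneg_sums.induct)
    case (add a b)
    then have "- a + - b \<in> G" by (intro G_add[OF minus_pos]) auto
    then show ?case by simp
  qed (use zero in simp)
  have minus_V: "- u \<in> G" if "u \<in> ?V" for u
    using that
  proof (induction rule: nonneg_sums.induct)
    case (add a b)
    then have "- a + - b \<in> G" by (intro G_add[OF minus_neg]) auto
    then show ?case by simp
  qed (use zero in simp)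
  have minus: "- a \<in> G" if a: "a \<in> G" for a
  proof -
    obtain u v where "u \<in> ?U" "v \<in> ?V" "a = u + v" using a unfolding G_def by auto
    then show ?thesis using G_add[OF minus_U minus_V] by simp
  qed
  have A: "a \<in> G" if "a \<in> A" for a
    using mult_pos[of a 1] mult_neg[of a 1] zero that by (cases a "0::int" rule: linorder_cases) auto
  have "a \<in> G" if "a \<in> group_closure A" for a
    using that
  proof (induction rule: group_closure.induct)
    case (diff s t)
    then show ?case using G_add[OF _ minus, of s t] by simp
  qed (use zero A in auto)
  moreover have "z \<in> group_closure A"
    using assms(2) unfolding group_closure_eq by auto
  ultimately show ?thesis using that unfolding G_def by blast
qed

section \<open>The jump graph and its reflection\<close>

definition osc_step :: "int set \<Rightarrow> int set \<Rightarrow> int \<Rightarrow> int \<Rightarrow> bool" where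
  "osc_step A B x y \<longleftrightarrow> y - x \<in> (if x < 0 then A else B)"

abbreviation osc_reach :: "int set \<Rightarrow> int set \<Rightarrow> int \<Rightarrow> int \<Rightarrow> bool" where
  "osc_reach A B \<equiv> (osc_step A B)\<^sup>*\<^sup>*"

text \<open>The centre of the reflection is -1/2 because 0 counts as nonnegative:
  \<open>x < 0\<close> holds exactly when \<open>- 1 - x \<ge> 0\<close>. Thus the half-lines are
  exchanged and every jump changes sign.\<close>

lemma osc_step_reflect:
  "osc_step (uminus ` B) (uminus ` A) x y \<longleftrightarrow> osc_step A B (- 1 - x) (- 1 - y)"
proof -
  have "z \<in> uminus ` C \<longleftrightarrow> - z \<in> C" for z :: int and C by force
  then show ?thesis by (auto simp: osc_step_def)
qed

lemma osc_reach_reflect: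
  "osc_reach (uminus ` B) (uminus ` A) x y \<longleftrightarrow> osc_reach A B (- 1 - x) (- 1 - y)"
proof -
  have *: "osc_reach A B (- 1 - x) (- 1 - y)" if "osc_reach (uminus ` B) (uminus ` A) x y" for A B x y
    using that
    by induction (auto intro: rtranclp.rtrancl_into_rtrancl simp: osc_step_reflect)
  show ?thesis
    \<comment> \<open>The reflection is an involution, so the same implication for the reflected
      data is the converse.\<close>
    using *[of B A x y] *[of "uminus ` A" "uminus ` B" "- 1 - x" "- 1 - y"] by (auto simp: image_image)
qed

section \<open>Moves inside one half-line\<close>

lemma osc_reach_up:
  "u \<in> nonneg_sums (B \<inter> {0<..}) \<Longrightarrow> x \<ge> 0 \<Longrightarrow> osc_reach A B x (x + u)"
proof (induction arbitrary: x rule: nonneg_sums.induct)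
  case (add a b)
  then have "osc_step A B x (x + a)" by (simp add: osc_step_def)
  moreover have "osc_reach A B (x + a) (x + a + b)" using add by auto
  ultimately show ?case by (simp add: add.assoc converse_rtranclp_into_rtranclp)
qed simp

text \<open>Downward jumps only lower the position, so every intermediate point is at least the end
  point \<open>x + v\<close>, hence nonnegative, and each jump is indeed taken from
  \<open>B\<close>.\<close>

lemma osc_reach_down:
  "v \<in> nonneg_sums (B \<inter> {..<0}) \<Longrightarrow> x + v \<ge> 0 \<Longrightarrow> osc_reach A B x (x + v)"
proof (induction arbitrary: x rule: nonneg_sums.induct)
  case (add a b)
  have "b \<le> 0" using add.hyps(2) by induction auto
  then have "osc_step A B x (x + a)" using add by (simp add: osc_step_def)
  moreover have "osc_reach A B (x + a) (x + a + b)" using add.IH[of "x + a"] add.prems by (simp add: add.assoc)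
  ultimately show ?case by (simp add: add.assoc converse_rtranclp_into_rtranclp)
qed simp

text \<open>The last jump is \<open>s\<close>, so only the point before it has to be nonnegative.\<close>
lemma osc_reach_nonneg:
  assumes "two_sided B" "0 \<le> x" "Gcd B dvd y - x" "s \<in> B" "s \<le> 0" "s \<le> y"
  shows "osc_reach A B x y"
proof -
  have "Gcd B dvd (y - x) - s" by (rule dvd_diff) (use assms in auto)
  then obtain u v where uv: "u \<in> nonneg_sums (B \<inter> {0<..})" "v \<in> nonneg_sums (B \<inter> {..<0})"
    "y - x - s = u + v" using up_down_decomposition[OF assms(1)] by blast
  have eq: "x + u + v = y - s" using uv(3) by linarith
  have "osc_reach A B x (x + u)" using uv assms by (intro osc_reach_up) auto
  also have "osc_reach A B (x + u) (x + u + v)"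
    using uv(2) eq assms by (intro osc_reach_down) auto
  also have "osc_step A B (x + u + v) y"
    unfolding eq osc_step_def using assms by auto
  finally show ?thesis .
qed

lemma two_sided_uminus [simp]: "two_sided (uminus ` A) \<longleftrightarrow> two_sided A"
proof -
  have "(uminus ` A) \<inter> {0<..} = uminus ` (A \<inter> {..<0})"
       "(uminus ` A) \<inter> {..<0} = uminus ` (A \<inter> {0<..})" by force+
  then show ?thesis by (auto simp: two_sided_def)
qed

lemma Gcd_uminus [simp]: "Gcd (uminus ` A) = Gcd A" for A :: "int set"
proof -
  have "Gcd (abs ` uminus ` A) = Gcd (abs ` A)" by (simp add: image_image)
  then show ?thesis by simp
qed

text \<open>Mirror image of \<open>osc_reach_nonneg\<close>. The bound becomes strict because
  \<open>- s \<le> - 1 - y\<close> means \<open>y < s\<close>.\<close>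

lemma osc_reach_neg:
  assumes "two_sided A" "x < 0" "Gcd A dvd y - x" "s \<in> A" "0 \<le> s" "y < s"
  shows "osc_reach A B x y"
proof -
  have "Gcd A dvd x - y" using assms(3) by (simp add: dvd_diff_commute)
  then have "osc_reach (uminus ` B) (uminus ` A) (- 1 - x) (- 1 - y)"
    using assms by (intro osc_reach_nonneg[where s = "- s"]) auto
  then show ?thesis by (simp add: osc_reach_reflect)
qed

lemma two_sidedE:
  assumes "two_sided A"
  obtains p n where "p \<in> A" "Gcd A \<le> p" "n \<in> A" "n \<le> - Gcd A"
proof -
  obtain p n where *: "p \<in> A" "p > 0" "n \<in> A" "n < 0"
    using assms unfolding two_sided_def by blast
  then have "Gcd A \<le> p" "Gcd A \<le> - n" by (auto intro!: zdvd_imp_le)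
  with * show ?thesis by (intro that[of p n]) auto
qed

lemma two_sided_Gcd_pos: "two_sided A \<Longrightarrow> Gcd A > 0"
  using Gcd_int_greater_eq_0[of A] by (fastforce simp: two_sided_def order_less_le)

section \<open>Excursions between the two half-lines\<close>

lemma osc_reach_some_neg:
  assumes "two_sided B"
  obtains z where "z < 0" "osc_reach A B x z"
proof (cases "x < 0")
  case False
  let ?d = "Gcd B"
  obtain n where n: "n \<in> B" "n \<le> - ?d" using assms by (rule two_sidedE)
  have m: "0 \<le> x mod ?d" "x mod ?d < ?d" using two_sided_Gcd_pos[OF assms] by auto
  have "?d dvd x mod ?d - ?d - x" by (simp add: mod_eq_dvd_iff[symmetric])
  \<comment> \<open>The target lies between \<open>- Gcd B\<close> and \<open>- 1\<close>, so a
    final jump \<open>n \<le> - Gcd B\<close> arrives there from a nonnegative point.\<close>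
  then have "osc_reach A B x (x mod ?d - ?d)"
    by (rule osc_reach_nonneg[OF assms _ _ n(1), rotated]) (use False n m in auto)
  with m show ?thesis by (intro that[of "x mod ?d - ?d"]) auto
qed (use that in auto)

text \<open>Each of the \<open>k\<close> rounds climbs to the residue \<open>w\<close> in
  \<open>{0..<Gcd A}\<close> and drops to \<open>w - Gcd B\<close>, which shifts the class modulo
  \<open>Gcd A\<close> by \<open>- Gcd B\<close>. As \<open>w < Gcd A \<le> Gcd B\<close>, the round
  ends below zero and can be repeated.\<close>

lemma osc_reach_neg_shift:
  assumes A: "two_sided A" and B: "two_sided B" and le: "Gcd A \<le> Gcd B" and x: "x < 0"
  obtains z where "z < 0" "osc_reach A B x z" "Gcd A dvd z - (x - int k * Gcd B)"
proof -
  obtain p where p: "p \<in> A" "Gcd A \<le> p" using A by (rule two_sidedE)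
  obtain n where n: "n \<in> B" "n \<le> - Gcd B" using B by (rule two_sidedE)
  have "\<exists>z<0. osc_reach A B x z \<and> Gcd A dvd z - (x - int k * Gcd B)"
  proof (induction k)
    case 0
    then show ?case using x by auto
  next
    case (Suc k)
    then obtain z where z: "z < 0" "osc_reach A B x z" "Gcd A dvd z - (x - int k * Gcd B)"
      by auto
    define w where "w = z mod Gcd A"
    have w: "0 \<le> w" "w < Gcd A" "Gcd A dvd w - z"
      using two_sided_Gcd_pos[OF A] by (auto simp: w_def mod_eq_dvd_iff[symmetric])
    have "osc_reach A B z w"
      by (rule osc_reach_neg[OF A z(1) w(3) p(1)]) (use w p in auto)
    moreover have "osc_reach A B w (w - Gcd B)"
      by (rule osc_reach_nonneg[OF B w(1) _ n(1)]) (use w n le in auto)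
    ultimately have "osc_reach A B x (w - Gcd B)" using z(2) by simp
    moreover have "Gcd A dvd (w - z) + (z - (x - int k * Gcd B))"
      using w(3) z(3) by (rule dvd_add)
    ultimately show ?case
      using w(2) le by (intro exI[of _ "w - Gcd B"]) (auto simp: algebra_simps)
  qed
  then show ?thesis using that by blast
qed

text \<open>By Bezout, a suitable number of rounds brings the walk to a negative point congruent to
  \<open>y\<close> modulo \<open>Gcd A\<close>; jumps from \<open>A\<close> then finish.\<close>

lemma osc_reach_neg_gcd:
  assumes A: "two_sided A" and B: "two_sided B" and le: "Gcd A \<le> Gcd B"
    and x: "x < 0" and y: "gcd (Gcd A) (Gcd B) dvd y - x" and s: "s \<in> A" "0 \<le> s" "y < s"
  shows "osc_reach A B x y"
proof -
  let ?d = "Gcd A" and ?d' = "Gcd B"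
  obtain c where c: "y - x = gcd ?d ?d' * c" using y by auto
  obtain u v where uv: "u * ?d + v * ?d' = gcd ?d ?d'" using bezout_int by blast
  \<comment> \<open>Modulo \<open>?d\<close>, the difference \<open>y - x\<close> is
    \<open>v * c * ?d'\<close>, so \<open>k\<close> rounds of \<open>- ?d'\<close> fit when
    \<open>k\<close> is congruent to \<open>- (v * c)\<close>. The remainder provides a nonnegative
    choice.\<close>
  define k where "k = nat ((- (v * c)) mod ?d)"
  have k: "?d dvd int k + v * c"
    using two_sided_Gcd_pos[OF A] unfolding k_def
    by (simp add: dvd_eq_mod_eq_0 mod_simps)
  obtain z where z: "z < 0" "osc_reach A B x z" "?d dvd z - (x - int k * ?d')"
    using osc_reach_neg_shift[OF A B le x] by blast
  have "y - (x - int k * ?d') = ?d * (u * c) + (int k + v * c) * ?d'"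
    using c unfolding uv[symmetric] by (simp add: algebra_simps)
  then have "?d dvd y - (x - int k * ?d')" using k by simp
  from dvd_diff[OF this z(3)] have "?d dvd y - z" by simp
  then show ?thesis using osc_reach_neg[OF A z(1) _ s] z(2) by (meson rtranclp_trans)
qed

lemma osc_reach_dvd: "osc_reach A B x y \<Longrightarrow> gcd (Gcd A) (Gcd B) dvd y - x"
proof (induction rule: rtranclp_induct)
  case (step y z)
  have "gcd (Gcd A) (Gcd B) dvd z - y"
    using step.hyps(2) by (auto simp: osc_step_def split: if_splits intro: dvd_trans[OF _ Gcd_dvd])
  from dvd_add[OF this step.IH] show ?case by simp
qed simp

text \<open>The walk first goes below zero. A negative \<open>y\<close> is then reached directly; a
  nonnegative \<open>y\<close> is reached through its residue \<open>w\<close> modulo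
  \<open>Gcd B\<close>, on which a jump \<open>s > w\<close> can land from below zero, followed by
  jumps from \<open>B\<close>.\<close>

lemma osc_reachI:
  assumes A: "two_sided A" and B: "two_sided B" and le: "Gcd A \<le> Gcd B"
    and dvd: "gcd (Gcd A) (Gcd B) dvd y - x" and y: "y < 0 \<or> (\<exists>s\<in>A. y mod Gcd B < s)"
  shows "osc_reach A B x y"
proof -
  let ?\<delta> = "gcd (Gcd A) (Gcd B)"
  obtain z where z: "z < 0" "osc_reach A B x z" using osc_reach_some_neg[OF B] by blast
  have zy: "?\<delta> dvd y - z" using dvd_diff[OF dvd osc_reach_dvd[OF z(2)]] by simp
  have "osc_reach A B z y"
  proof (cases "y < 0")
    case True
    obtain p where "p \<in> A" "Gcd A \<le> p" using A by (rule two_sidedE)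
    then show ?thesis
      using osc_reach_neg_gcd[OF A B le z(1) zy, of p] True two_sided_Gcd_pos[OF A] by auto
  next
    case False
    define w where "w = y mod Gcd B"
    obtain s where s: "s \<in> A" "w < s" using False y w_def by auto
    have w: "0 \<le> w" "Gcd B dvd y - w" using two_sided_Gcd_pos[OF B]
      by (auto simp: w_def mod_eq_dvd_iff[symmetric])
    have "?\<delta> dvd y - w" using w(2) by (rule dvd_trans[rotated]) simp
    from dvd_diff[OF zy this] have "?\<delta> dvd w - z" by simp
    then have "osc_reach A B z w" using osc_reach_neg_gcd[OF A B le z(1)] s w by auto
    moreover obtain n where "n \<in> B" "n \<le> - Gcd B" using B by (rule two_sidedE)
    then have "osc_reach A B w y"
      using osc_reach_nonneg[OF B w, of n] False two_sided_Gcd_pos[OF B] by auto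
    ultimately show ?thesis by simp
  qed
  with z(2) show ?thesis by simp
qed

section \<open>Essential and transient points of the jump graph\<close>

lemma essential_iff:
  assumes "reflp R" "transp R"
  shows "essential R x \<longleftrightarrow> (\<forall>y. R x y \<longrightarrow> R y x)"
proof -
  have le: "class_le R (irr_class R x) (irr_class R y) \<longleftrightarrow> R x y" for y
    using assms unfolding class_le_def irr_class_def by (auto dest: reflpD transpD)
  have eq: "irr_class R y = irr_class R x \<longleftrightarrow> R x y \<and> R y x" for y
    using assms unfolding irr_class_def set_eq_iff by (auto dest: reflpD transpD)
  show ?thesis
    unfolding essential_def essential_class_def irr_classes_def using le eq by auto
qed

lemma essential_osc_reach:
  "essential (osc_reach A B) x \<longleftrightarrow> (\<forall>y. osc_reach A B x y \<longrightarrow> osc_reach A B y x)"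
  by (rule essential_iff) (auto intro!: reflpI transpI)

text \<open>The high-residue points can be entered only from points of the same kind: jumps from
  nonnegative points preserve the residue modulo \<open>Gcd B\<close>, and jumps from negative
  points land below \<open>m\<close>. The induction therefore runs backwards along the path.\<close>

lemma osc_reach_into_high_residue:
  assumes B: "two_sided B" and m: "\<forall>a\<in>A. a \<le> m" "m < Gcd B"
    and "osc_reach A B x y" "0 \<le> y" "m \<le> y mod Gcd B"
  shows "0 \<le> x \<and> m \<le> x mod Gcd B \<and> Gcd B dvd y - x"
  using assms(4-6)
proof (induction rule: converse_rtranclp_induct)
  case (step x z)
  have "0 \<le> x"
  proof (rule ccontr)
    assume neg: "\<not> 0 \<le> x"
    then have "z - x \<in> A" using step.hyps by (simp add: osc_step_def)
    then have "z < m" using m(1) neg by fastforce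
    \<comment> \<open>By induction \<open>z\<close> is nonnegative, and \<open>z < m < Gcd B\<close>
      makes it its own residue, contradicting \<open>m \<le> z mod Gcd B\<close>.\<close>
    moreover have "z mod Gcd B = z" using step \<open>z < m\<close> m(2) by simp
    ultimately show False using step by simp
  qed
  then have "Gcd B dvd z - x" using step.hyps by (simp add: osc_step_def)
  moreover then have "x mod Gcd B = z mod Gcd B" by (metis mod_eq_dvd_iff)
  moreover have "Gcd B dvd (y - z) + (z - x)" using step \<open>Gcd B dvd z - x\<close> by (intro dvd_add) auto
  ultimately show ?case using step \<open>0 \<le> x\<close> by simp
qed simp

text \<open>The point leads below zero, from where no path returns to it, so it is not essential.
  Within its class modulo \<open>Gcd B\<close>, points at or above \<open>m\<close> are nonnegative
  and communicate by jumps from \<open>B\<close> alone.\<close>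

lemma osc_reach_high_residue:
  assumes A: "two_sided A" and B: "two_sided B" and m: "\<forall>a\<in>A. a \<le> m" "m \<in> A" "m < Gcd B"
    and x: "0 \<le> x" "m \<le> x mod Gcd B"
  shows "\<not> essential (osc_reach A B) x" (is ?inessential)
    and "irr_class (osc_reach A B) x = {y. Gcd B dvd y - x \<and> m \<le> y}" (is "?I = ?J")
proof -
  obtain z where z: "z < 0" "osc_reach A B x z" using osc_reach_some_neg[OF B] by blast
  have "\<not> osc_reach A B z x"
    using osc_reach_into_high_residue[OF B m(1,3) _ x, where x = z] z(1) by auto
  with z(2) show ?inessential by (auto simp: essential_osc_reach)
  obtain p where p: "p \<in> A" "Gcd A \<le> p" using A by (rule two_sidedE)
  then have m0: "0 < m" using m(1) two_sided_Gcd_pos[OF A] by fastforce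
  obtain n where n: "n \<in> B" "n \<le> - Gcd B" using B by (rule two_sidedE)
  have n0: "n < 0" using n two_sided_Gcd_pos[OF B] by auto
  show "?I = ?J"
  proof (intro set_eqI iffI)
    fix y assume "y \<in> ?I"
    then have "osc_reach A B y x" by (simp add: irr_class_def)
    then have *: "0 \<le> y" "m \<le> y mod Gcd B" "Gcd B dvd x - y"
      using osc_reach_into_high_residue[OF B m(1,3) _ x, where x = y] by auto
    moreover have "y mod Gcd B \<le> y" using * by (intro zmod_le_nonneg_dividend)
    ultimately show "y \<in> ?J" by (simp add: dvd_diff_commute)
  next
    fix y assume y: "y \<in> ?J"
    then have "osc_reach A B x y" using osc_reach_nonneg[OF B x(1) _ n(1)] n0 m0 by auto
    moreover have "osc_reach A B y x"
      using osc_reach_nonneg[OF B _ _ n(1), of y x] y n0 m0 x(1) by (auto simp: dvd_diff_commute)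
    ultimately show "y \<in> ?I" by (simp add: irr_class_def)
  qed
qed

text \<open>The complement of the high-residue set is closed, and on it reachability is congruence
  modulo the gcd, a symmetric relation.\<close>

lemma osc_reach_low_residue:
  assumes A: "two_sided A" and B: "two_sided B" and m: "\<forall>a\<in>A. a \<le> m" "m \<in> A" "m < Gcd B"
    and x: "\<not> (0 \<le> x \<and> m \<le> x mod Gcd B)"
  shows "essential (osc_reach A B) x" (is ?essential)
    and "irr_class (osc_reach A B) x
      = {y. gcd (Gcd A) (Gcd B) dvd y - x \<and> \<not> (0 \<le> y \<and> m \<le> y mod Gcd B)}" (is "?I = ?J")
proof -
  obtain p where p: "p \<in> A" "Gcd A \<le> p" using A by (rule two_sidedE)
  have le: "Gcd A \<le> Gcd B" using p m(1,3) by fastforce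
  have reach: "osc_reach A B x y \<longleftrightarrow>
      gcd (Gcd A) (Gcd B) dvd y - x \<and> \<not> (0 \<le> y \<and> m \<le> y mod Gcd B)"
    if "\<not> (0 \<le> x \<and> m \<le> x mod Gcd B)" for x y
  proof
    assume "osc_reach A B x y"
    then show "gcd (Gcd A) (Gcd B) dvd y - x \<and> \<not> (0 \<le> y \<and> m \<le> y mod Gcd B)"
      using osc_reach_into_high_residue[OF B m(1,3), of x y] osc_reach_dvd[of A B x y] that by auto
  next
    assume "gcd (Gcd A) (Gcd B) dvd y - x \<and> \<not> (0 \<le> y \<and> m \<le> y mod Gcd B)"
    then show "osc_reach A B x y"
      using osc_reachI[OF A B le] m(2) by (auto simp: not_le)
  qed
  show ?essential
    using x by (auto simp: essential_osc_reach reach dvd_diff_commute)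
  show "?I = ?J"
    using x by (auto simp: irr_class_def reach dvd_diff_commute)
qed

text \<open>A jump \<open>s \<ge> Gcd B\<close> exceeds every residue modulo \<open>Gcd B\<close>,
  so every nonnegative point can be entered when \<open>Gcd A \<le> Gcd B\<close>. In the opposite
  order the reflection applies, with \<open>- t\<close> in the role of \<open>s\<close>.\<close>

lemma osc_reach_iff:
  assumes A: "two_sided A" and B: "two_sided B"
    and s: "s \<in> A" "Gcd B \<le> s" and t: "t \<in> B" "t \<le> - Gcd A"
  shows "osc_reach A B x y \<longleftrightarrow> gcd (Gcd A) (Gcd B) dvd y - x"
proof -
  have *: "osc_reach A B x y"
    if A: "two_sided A" and B: "two_sided B" and s: "s \<in> A" "Gcd B \<le> s" and le: "Gcd A \<le> Gcd B"
      and dvd: "gcd (Gcd A) (Gcd B) dvd y - x" for A B :: "int set" and s x y :: int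
    using osc_reachI[OF A B le dvd] s two_sided_Gcd_pos[OF B] pos_mod_bound[of "Gcd B" y]
      order_less_le_trans by blast
  have "osc_reach A B x y" if dvd: "gcd (Gcd A) (Gcd B) dvd y - x"
  proof (cases "Gcd A \<le> Gcd B")
    case True
    then show ?thesis by (intro *[OF A B s _ dvd])
  next
    case False
    have "osc_reach (uminus ` B) (uminus ` A) (- 1 - x) (- 1 - y)"
      by (rule *[where s = "- t"]) (use assms dvd False in \<open>auto simp: gcd.commute dvd_diff_commute\<close>)
    then show ?thesis by (simp add: osc_reach_reflect)
  qed
  then show ?thesis using osc_reach_dvd by blast
qed


section \<open>From the random walk to the jump graph\<close>

context oscillating_steps
begin

lemma measurable_pairs: "n \<ge> 1 \<Longrightarrow> (\<lambda>\<omega>. (\<xi> n \<omega>, \<xi>' n \<omega>)) \<in> M \<rightarrow>\<^sub>M count_space UNIV"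
  using indep_pairs by (auto simp: indep_vars_def)

lemma measurable_xi: "n \<ge> 1 \<Longrightarrow> \<xi> n \<in> M \<rightarrow>\<^sub>M count_space UNIV"
  using measurable_compose[OF measurable_pairs, of n fst "count_space UNIV"] by simp

lemma measurable_xi': "n \<ge> 1 \<Longrightarrow> \<xi>' n \<in> M \<rightarrow>\<^sub>M count_space UNIV"
  using measurable_compose[OF measurable_pairs, of n snd "count_space UNIV"] by simp

lemma measurable_osc_walk: "osc_walk \<xi> \<xi>' x n \<in> M \<rightarrow>\<^sub>M count_space UNIV"
proof (induction n)
  case (Suc n)
  have "(\<lambda>\<omega>. if z \<le> - 1 then z + \<xi> (Suc n) \<omega> else z + \<xi>' (Suc n) \<omega>) \<in> M \<rightarrow>\<^sub>M count_space UNIV" for z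
    using measurable_compose[OF measurable_xi[of "Suc n"], of "(+) z" "count_space UNIV"]
      measurable_compose[OF measurable_xi'[of "Suc n"], of "(+) z" "count_space UNIV"]
    by simp
  \<comment> \<open>The position at time \<open>n\<close> has countably many values, so it suffices
    to treat each fixed value \<open>z\<close>.\<close>
  from measurable_compose_countable[OF this Suc] show ?case by simp
qed simp

lemma prob_xi: "n \<ge> 1 \<Longrightarrow> prob (\<xi> n -` X \<inter> space M) = measure_pmf.prob \<mu> X"
  using measure_distr[OF measurable_xi, of n X] distr_xi[of n] by simp

lemma prob_xi': "n \<ge> 1 \<Longrightarrow> prob (\<xi>' n -` X \<inter> space M) = measure_pmf.prob \<mu>' X"
  using measure_distr[OF measurable_xi', of n X] distr_xi'[of n] by simp

lemma AE_steps_in_support: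
  "AE \<omega> in M. \<forall>n\<ge>1. \<xi> n \<omega> \<in> set_pmf \<mu> \<and> \<xi>' n \<omega> \<in> set_pmf \<mu>'"
proof -
  have 1: "AE \<omega> in M. \<xi> n \<omega> \<in> set_pmf \<mu>" if "n \<ge> 1" for n
  proof -
    have "AE z in distr M (count_space UNIV) (\<xi> n). z \<in> set_pmf \<mu>"
      unfolding distr_xi[OF that] by (rule AE_pmfI)
    then show ?thesis by (subst (asm) AE_distr_iff) (use measurable_xi[OF that] in auto)
  qed
  have 2: "AE \<omega> in M. \<xi>' n \<omega> \<in> set_pmf \<mu>'" if "n \<ge> 1" for n
  proof -
    have "AE z in distr M (count_space UNIV) (\<xi>' n). z \<in> set_pmf \<mu>'"
      unfolding distr_xi'[OF that] by (rule AE_pmfI)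
    then show ?thesis by (subst (asm) AE_distr_iff) (use measurable_xi'[OF that] in auto)
  qed
  have "AE \<omega> in M. n \<ge> 1 \<longrightarrow> \<xi> n \<omega> \<in> set_pmf \<mu> \<and> \<xi>' n \<omega> \<in> set_pmf \<mu>'" for n
    using 1[of n] 2[of n] by (cases "n \<ge> 1") auto
  then show ?thesis by (simp add: AE_all_countable)
qed

text \<open>An event of positive probability contains an outcome all of whose increments lie in the
  supports; its trajectory is a path in the graph.\<close>

lemma osc_reach_if_leads_to:
  assumes "leads_to M \<xi> \<xi>' x y"
  shows "osc_reach (set_pmf \<mu>) (set_pmf \<mu>') x y"
proof -
  obtain n where n: "prob {\<omega> \<in> space M. osc_walk \<xi> \<xi>' x n \<omega> = y} > 0"
    using assms unfolding leads_to_def by auto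
  have "\<exists>\<omega>. osc_walk \<xi> \<xi>' x n \<omega> = y \<and> (\<forall>n\<ge>1. \<xi> n \<omega> \<in> set_pmf \<mu> \<and> \<xi>' n \<omega> \<in> set_pmf \<mu>')"
  proof (rule ccontr)
    assume "\<not> ?thesis"
    then have "AE \<omega> in M. \<not> osc_walk \<xi> \<xi>' x n \<omega> = y"
      using AE_steps_in_support by (auto elim!: eventually_mono)
    then have "prob {\<omega> \<in> space M. osc_walk \<xi> \<xi>' x n \<omega> = y} = 0"
      by (subst prob_eq_0) (use measurable_osc_walk in \<open>auto elim: eventually_mono\<close>)
    with n show False by simp
  qed
  then obtain \<omega> where \<omega>: "osc_walk \<xi> \<xi>' x n \<omega> = y"
    "\<And>n. n \<ge> 1 \<Longrightarrow> \<xi> n \<omega> \<in> set_pmf \<mu> \<and> \<xi>' n \<omega> \<in> set_pmf \<mu>'" by blast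
  have "osc_reach (set_pmf \<mu>) (set_pmf \<mu>') x (osc_walk \<xi> \<xi>' x k \<omega>)" for k
  proof (induction k)
    case (Suc k)
    have "osc_step (set_pmf \<mu>) (set_pmf \<mu>') (osc_walk \<xi> \<xi>' x k \<omega>) (osc_walk \<xi> \<xi>' x (Suc k) \<omega>)"
      using \<omega>(2)[of "Suc k"] by (auto simp: osc_step_def)
    with Suc show ?case by (rule rtranclp.rtrancl_into_rtrancl)
  qed simp
  with \<omega>(1) show ?thesis by metis
qed

text \<open>Along a fixed path \<open>f\<close>, the event \<open>E i\<close> prescribes only the
  component of the pair that the walk uses at time \<open>i\<close>, so a marginal law gives its
  probability. Independence in time multiplies these positive numbers.\<close>

lemma leads_to_if_osc_reach:
  assumes "osc_reach (set_pmf \<mu>) (set_pmf \<mu>') x y"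
  shows "leads_to M \<xi> \<xi>' x y"
proof -
  obtain n where "(osc_step (set_pmf \<mu>) (set_pmf \<mu>') ^^ n) x y"
    using assms by (auto dest: rtranclp_imp_relpowp)
  then obtain f where f: "f 0 = x" "f n = y"
    "\<And>i. i < n \<Longrightarrow> osc_step (set_pmf \<mu>) (set_pmf \<mu>') (f i) (f (Suc i))"
    by (auto simp: relpowp_fun_conv)
  define inc where "inc i z = (if f (i - 1) < 0 then fst z else snd z)" for i and z :: "int \<times> int"
  define Q where "Q i = {z. inc i z = f i - f (i - 1)}" for i
  define E where "E i = (\<lambda>\<omega>. (\<xi> i \<omega>, \<xi>' i \<omega>)) -` Q i \<inter> space M" for i
  have E_pos: "prob (E i) > 0" if i: "i \<in> {1..n}" for i
  proof -
    have "osc_step (set_pmf \<mu>) (set_pmf \<mu>') (f (i - 1)) (f i)" using f(3)[of "i - 1"] i by auto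
    moreover have "E i = (if f (i - 1) < 0 then \<xi> i else \<xi>' i) -` {f i - f (i - 1)} \<inter> space M"
      by (auto simp: E_def Q_def inc_def)
    ultimately show ?thesis
      using i by (auto simp: osc_step_def prob_xi prob_xi' measure_pmf_single pmf_positive split: if_splits)
  qed
  have "prob (\<Inter>i\<in>{1..n}. E i) > 0" if "n > 0"
  proof -
    have "prob (\<Inter>i\<in>{1..n}. E i) = (\<Prod>i\<in>{1..n}. prob (E i))"
      unfolding E_def by (rule indep_varsD[OF indep_pairs]) (use that in auto)
    also have "\<dots> > 0" using E_pos by (rule prod_pos)
    finally show ?thesis .
  qed
  \<comment> \<open>For \<open>n = 0\<close> the intersection over the empty index set is the whole
    type; meeting it with \<open>space M\<close> gives an event of probability 1.\<close>
  then have "prob ((\<Inter>i\<in>{1..n}. E i) \<inter> space M) > 0"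
  proof (cases "n = 0")
    case False
    then have "(\<Inter>i\<in>{1..n}. E i) \<subseteq> E 1" by auto
    then have "(\<Inter>i\<in>{1..n}. E i) \<inter> space M = (\<Inter>i\<in>{1..n}. E i)"
      unfolding E_def by blast
    with False \<open>n > 0 \<Longrightarrow> prob (\<Inter>i\<in>{1..n}. E i) > 0\<close> show ?thesis by simp
  qed (simp add: prob_space)
  moreover have "(\<Inter>i\<in>{1..n}. E i) \<inter> space M \<subseteq> {\<omega> \<in> space M. osc_walk \<xi> \<xi>' x n \<omega> = y}"
  proof
    fix \<omega> assume \<omega>: "\<omega> \<in> (\<Inter>i\<in>{1..n}. E i) \<inter> space M"
    have "k \<le> n \<Longrightarrow> osc_walk \<xi> \<xi>' x k \<omega> = f k" for k
    proof (induction k)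
      case (Suc k)
      then have "\<omega> \<in> E (Suc k)" using \<omega> by auto
      with Suc show ?case by (auto simp: E_def Q_def inc_def split: if_splits)
    qed (simp add: f)
    with \<omega> f(2) show "\<omega> \<in> {\<omega> \<in> space M. osc_walk \<xi> \<xi>' x n \<omega> = y}" by auto
  qed
  then have "prob ((\<Inter>i\<in>{1..n}. E i) \<inter> space M) \<le> prob {\<omega> \<in> space M. osc_walk \<xi> \<xi>' x n \<omega> = y}"
    by (rule finite_measure_mono) (use measurable_osc_walk in auto)
  ultimately show ?thesis unfolding leads_to_def by (intro exI[of _ n]) linarith
qed

lemma leads_to_eq_osc_reach: "leads_to M \<xi> \<xi>' = osc_reach (set_pmf \<mu>) (set_pmf \<mu>')"
  using osc_reach_if_leads_to leads_to_if_osc_reach by (intro ext iffI)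

end


section \<open>Transfer of the classes by reflection\<close>

lemma essential_osc_reach_reflect:
  "essential (osc_reach (uminus ` B) (uminus ` A)) (- 1 - x) \<longleftrightarrow> essential (osc_reach A B) x"
proof -
  have "(\<forall>y. P (- 1 - y)) \<longleftrightarrow> (\<forall>y. P y)" for P :: "int \<Rightarrow> bool"
    by (metis diff_diff_eq2 add_diff_cancel_left')
  then show ?thesis
    unfolding essential_osc_reach osc_reach_reflect by simp
qed

lemma irr_class_osc_reach_reflect:
  "y \<in> irr_class (osc_reach A B) x \<longleftrightarrow>
    - 1 - y \<in> irr_class (osc_reach (uminus ` B) (uminus ` A)) (- 1 - x)"
  by (simp add: irr_class_def osc_reach_reflect)

text \<open>After reflection the largest upward jump on the negative side is \<open>- m\<close> and
  the modulus on the nonnegative side is \<open>Gcd A\<close>; the bound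
  \<open>- m \<le> - 1 - y\<close> reads \<open>y \<le> m - 1\<close>.\<close>

lemma osc_reach_high_residue_reflected:
  assumes A: "two_sided A" and B: "two_sided B" and m: "\<forall>b\<in>B. m \<le> b" "m \<in> B" "- Gcd A < m"
    and x: "x < 0" "- m \<le> (- 1 - x) mod Gcd A"
  shows "\<not> essential (osc_reach A B) x"
    and "irr_class (osc_reach A B) x = {y. Gcd A dvd y - x \<and> y \<le> m - 1}"
proof -
  note * = osc_reach_high_residue[of "uminus ` B" "uminus ` A" "- m" "- 1 - x"]
  show "\<not> essential (osc_reach A B) x"
    using *(1) assms by (auto simp: essential_osc_reach_reflect)
  show "irr_class (osc_reach A B) x = {y. Gcd A dvd y - x \<and> y \<le> m - 1}"
    using *(2) assms unfolding set_eq_iff irr_class_osc_reach_reflect[of _ A B x]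
    by (auto simp: dvd_diff_commute)
qed

lemma osc_reach_low_residue_reflected:
  assumes A: "two_sided A" and B: "two_sided B" and m: "\<forall>b\<in>B. m \<le> b" "m \<in> B" "- Gcd A < m"
    and x: "\<not> (x < 0 \<and> - m \<le> (- 1 - x) mod Gcd A)"
  shows "essential (osc_reach A B) x"
    and "irr_class (osc_reach A B) x
      = {y. gcd (Gcd A) (Gcd B) dvd y - x \<and> \<not> (y < 0 \<and> - m \<le> (- 1 - y) mod Gcd A)}"
proof -
  note * = osc_reach_low_residue[of "uminus ` B" "uminus ` A" "- m" "- 1 - x"]
  have neg: "0 \<le> - 1 - y \<longleftrightarrow> y < 0" for y :: int by auto
  show "essential (osc_reach A B) x"
    using *(1) assms unfolding neg by (auto simp: essential_osc_reach_reflect)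
  have "irr_class (osc_reach (uminus ` B) (uminus ` A)) (- 1 - x) = {y. gcd (Gcd B) (Gcd A) dvd y - (- 1 - x) \<and>
    \<not> (0 \<le> y \<and> - m \<le> y mod Gcd A)}"
    using *(2) assms unfolding neg by simp
  then show "irr_class (osc_reach A B) x
      = {y. gcd (Gcd A) (Gcd B) dvd y - x \<and> \<not> (y < 0 \<and> - m \<le> (- 1 - y) mod Gcd A)}"
    unfolding set_eq_iff irr_class_osc_reach_reflect[of _ A B x]
    by (simp only: mem_Collect_eq neg gcd.commute) (auto simp: dvd_diff_commute)
qed

section \<open>Cosets and the exceptional sets in terms of residues\<close>

lemma elt_set_plus_multiples: "x +o {n * k |k. True} = {y. n dvd y - x}" for n x :: int
  unfolding elt_set_plus_def dvd_def by (auto simp: algebra_simps)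

lemma elt_set_plus_mod_multiples: "x mod n +o {n * k |k. True} = {y. n dvd y - x}" for n x :: int
  unfolding elt_set_plus_multiples by (simp add: mod_eq_dvd_iff[symmetric])


lemma residue_set_nonneg:
  assumes "0 \<le> m" "0 < n"
  shows "{k::int. m \<le> k \<and> k \<le> n - 1} + {n * k |k. k \<ge> 0} = {x. 0 \<le> x \<and> m \<le> x mod n}"
    (is "?L = ?R")
proof (intro set_eqI iffI)
  fix x assume "x \<in> ?L"
  then obtain a k where "m \<le> a" "a \<le> n - 1" "k \<ge> 0" "x = a + n * k"
    by (auto simp: set_plus_def)
  then show "x \<in> ?R" using assms by simp
next
  fix x assume x: "x \<in> ?R"
  then have "0 \<le> x div n" "x mod n \<le> n - 1"
    using assms by (auto simp: pos_imp_zdiv_nonneg_iff)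
  moreover have "x = x mod n + n * (x div n)" by simp
  ultimately show "x \<in> ?L" using x unfolding set_plus_def by blast
qed

text \<open>The substitution of \<open>- 1 - a\<close> for \<open>a\<close> and \<open>- k\<close>
  for \<open>k\<close> carries this set to the one treated in
  \<open>residue_set_nonneg\<close>.\<close>

lemma residue_set_neg:
  assumes "m \<le> 0" "0 < n"
  shows "{k::int. - n \<le> k \<and> k \<le> m - 1} + {n * k |k. k \<le> 0}
    = {x. x < 0 \<and> - m \<le> (- 1 - x) mod n}" (is "?L = ?R")
proof (rule set_eqI)
  fix x
  have "x \<in> ?L \<longleftrightarrow> - 1 - x \<in> {k. - m \<le> k \<and> k \<le> n - 1} + {n * k |k. k \<ge> 0}" (is "_ \<longleftrightarrow> _ \<in> ?L'")
  proof
    assume "x \<in> ?L"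
    then obtain a k where "- n \<le> a" "a \<le> m - 1" "k \<le> 0" "x = a + n * k"
      by (auto simp: set_plus_def)
    then have "- m \<le> - 1 - a" "- 1 - a \<le> n - 1" "- k \<ge> 0" "- 1 - x = (- 1 - a) + n * (- k)"
      by auto
    then show "- 1 - x \<in> ?L'" unfolding set_plus_def by blast
  next
    assume "- 1 - x \<in> ?L'"
    then obtain a k where "- m \<le> a" "a \<le> n - 1" "k \<ge> 0" "- 1 - x = a + n * k"
      by (auto simp: set_plus_def)
    then have "- n \<le> - 1 - a" "- 1 - a \<le> m - 1" "- k \<le> 0" "x = (- 1 - a) + n * (- k)"
      by auto
    then show "x \<in> ?L" unfolding set_plus_def by blast
  qed
  then show "x \<in> ?L \<longleftrightarrow> x \<in> ?R"
    using residue_set_nonneg[of "- m" n] assms by auto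
qed

section \<open>Attained and infinite extrema of the supports\<close>

lemma int_Sup_max:
  fixes S :: "int set"
  assumes "S \<noteq> {}" "bdd_above S"
  shows "Sup S \<in> S" "\<forall>s\<in>S. s \<le> Sup S"
proof -
  show le: "\<forall>s\<in>S. s \<le> Sup S" using assms(2) by (auto intro: cSup_upper)
  \<comment> \<open>An integer above \<open>Sup S - 1\<close> and at most \<open>Sup S\<close>
    equals \<open>Sup S\<close>, so the supremum is attained.\<close>
  obtain s where "s \<in> S" "Sup S - 1 < s" using less_cSupD[OF assms(1), of "Sup S - 1"] by auto
  with le have "s = Sup S" by fastforce
  with \<open>s \<in> S\<close> show "Sup S \<in> S" by simp
qed

lemma int_Inf_min:
  fixes S :: "int set"
  assumes "S \<noteq> {}" "bdd_below S"
  shows "Inf S \<in> S" "\<forall>s\<in>S. Inf S \<le> s"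
proof -
  show le: "\<forall>s\<in>S. Inf S \<le> s" using assms(2) by (auto intro: cInf_lower)
  obtain s where "s \<in> S" "s < Inf S + 1" using cInf_lessD[OF assms(1), of "Inf S + 1"] by auto
  with le have "s = Inf S" by fastforce
  with \<open>s \<in> S\<close> show "Inf S \<in> S" by simp
qed

lemma ext_max_less:
  assumes "S \<noteq> {}" "ext_max S < ereal c"
  obtains m where "ext_max S = ereal (of_int m)" "m \<in> S" "\<forall>s\<in>S. s \<le> m"
  using assms int_Sup_max[of S] by (auto simp: ext_max_def split: if_splits)

lemma ext_min_greater:
  assumes "S \<noteq> {}" "ereal c < ext_min S"
  obtains m where "ext_min S = ereal (of_int m)" "m \<in> S" "\<forall>s\<in>S. m \<le> s"
  using assms int_Inf_min[of S] by (auto simp: ext_min_def split: if_splits)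

text \<open>A bounded set attains its maximum, and an unbounded one has elements above any
  \<open>c\<close>; the infinite value of \<open>D\<close> is thus covered too.\<close>

lemma ext_max_ge:
  assumes "S \<noteq> {}" "ereal (of_int c) \<le> ext_max S"
  obtains s where "s \<in> S" "c \<le> s"
proof (cases "bdd_above S")
  case True
  then show ?thesis using assms int_Sup_max[of S] that by (auto simp: ext_max_def)
next
  case False
  then show ?thesis using that unfolding bdd_above_def by (meson linear)
qed

lemma ext_min_le:
  assumes "S \<noteq> {}" "ext_min S \<le> ereal (of_int c)"
  obtains s where "s \<in> S" "s \<le> c"
proof (cases "bdd_below S")
  case True
  then show ?thesis using assms int_Inf_min[of S] that by (auto simp: ext_min_def)
next
  case False
  then show ?thesis using that unfolding bdd_below_def by (meson linear)
qed

lemma irr_classes_eq_cosets: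
  fixes \<delta> :: int
  assumes "\<delta> > 0" and R: "\<And>x y. R x y \<longleftrightarrow> \<delta> dvd y - x"
  shows "irr_classes R = {r +o {\<delta> * k |k. True} |r. 0 \<le> r \<and> r < \<delta>}"
    and "int (card (irr_classes R)) = \<delta>"
    and "\<forall>C\<in>irr_classes R. essential_class R C"
proof -
  have cls: "irr_class R = (\<lambda>x. x mod \<delta> +o {\<delta> * k |k. True})"
    unfolding elt_set_plus_mod_multiples by (auto simp: irr_class_def R dvd_diff_commute)
  have "irr_classes R = (\<lambda>r. r +o {\<delta> * k |k. True}) ` range (\<lambda>x. x mod \<delta>)"
    unfolding irr_classes_def cls by (simp add: image_image)
  also have "range (\<lambda>x. x mod \<delta>) = {0..<\<delta>}"
  proof (intro equalityI subsetI)
    fix r assume "r \<in> {0..<\<delta>}"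
    then have "r = r mod \<delta>" by simp
    then show "r \<in> range (\<lambda>x. x mod \<delta>)" by (rule image_eqI) simp
  qed (use assms(1) in auto)
  finally have img: "irr_classes R = (\<lambda>r. r +o {\<delta> * k |k. True}) ` {0..<\<delta>}" .
  then show "irr_classes R = {r +o {\<delta> * k |k. True} |r. 0 \<le> r \<and> r < \<delta>}" by auto
  have "inj_on (\<lambda>r. r +o {\<delta> * k |k. True}) {0..<\<delta>}"
  proof (rule inj_onI)
    fix r s assume rs: "r \<in> {0..<\<delta>}" "s \<in> {0..<\<delta>}"
      "r +o {\<delta> * k |k. True} = s +o {\<delta> * k |k. True}"
    have "r \<in> r +o {\<delta> * k |k. True}" unfolding elt_set_plus_multiples by simp
    then have "\<delta> dvd r - s" unfolding rs(3) unfolding elt_set_plus_multiples by simp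
    with rs show "r = s" by (simp add: mod_eq_dvd_iff[symmetric])
  qed
  then show "int (card (irr_classes R)) = \<delta>"
    using assms(1) by (simp add: img card_image)
  have "essential R x" for x
  proof (subst essential_iff)
    show "transp R" unfolding R[abs_def] transp_def by (metis add_diff_eq diff_add_cancel dvd_add)
  qed (auto simp: R dvd_diff_commute intro: reflpI)
  then show "\<forall>C\<in>irr_classes R. essential_class R C"
    by (auto simp: irr_classes_def essential_def)
qed

section \<open>The three cases for the random walk\<close>

theorem theorem2p2:
  fixes M :: "'w measure"
    and \<mu> \<mu>' :: "int pmf"
    and \<xi> \<xi>' :: "nat \<Rightarrow> 'w \<Rightarrow> int"
    and R :: "int \<Rightarrow> int \<Rightarrow> bool"
    and D D' :: ereal
    and d d' \<delta> :: int
  assumes walk: "oscillating_steps M \<mu> \<mu>' \<xi> \<xi>'"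
    and pos: "set_pmf \<mu> \<inter> {0<..} \<noteq> {}"
    and neg: "set_pmf \<mu> \<inter> {..<0} \<noteq> {}"
    and pos': "set_pmf \<mu>' \<inter> {0<..} \<noteq> {}"
    and neg': "set_pmf \<mu>' \<inter> {..<0} \<noteq> {}"
    and R: "R = leads_to M \<xi> \<xi>'"
    and D: "D = ext_max (set_pmf \<mu>)"
    and D': "D' = ext_min (set_pmf \<mu>')"
    and d: "d = Gcd (set_pmf \<mu>)"
    and d': "d' = Gcd (set_pmf \<mu>')"
    and \<delta>: "\<delta> = gcd d d'"
    and neq: "d \<noteq> d'"
  shows
    "(D < ereal (of_int d') \<longrightarrow>
       (let T = {k::int. D \<le> ereal (of_int k) \<and> k \<le> d' - 1} + {d' * k |k. k \<ge> 0} in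
         (\<forall>x. x \<in> T \<longrightarrow>
            transient R x \<and>
            irr_class R x = (x +o {d' * k |k. True}) \<inter> {y. D \<le> ereal (of_int y)}) \<and>
         (\<forall>x. x \<notin> T \<longrightarrow>
            essential R x \<and>
            irr_class R x = ((x mod \<delta>) +o {\<delta> * k |k. True}) - T)))
     \<and>
     (D' > ereal (of_int (- d)) \<longrightarrow>
       (let T = {k::int. - d \<le> k \<and> ereal (of_int k) \<le> D' - 1} + {d * k |k. k \<le> 0} in
         (\<forall>x. x \<in> T \<longrightarrow>
            transient R x \<and>
            irr_class R x = (x +o {d * k |k. True}) \<inter> {y. ereal (of_int y) \<le> D' - 1}) \<and>
         (\<forall>x. x \<notin> T \<longrightarrow>
            essential R x \<and>
            irr_class R x = ((x mod \<delta>) +o {\<delta> * k |k. True}) - T)))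
     \<and>
     (D \<ge> ereal (of_int d') \<and> D' \<le> ereal (of_int (- d)) \<longrightarrow>
       irr_classes R = {r +o {\<delta> * k |k. True} |r. 0 \<le> r \<and> r < \<delta>} \<and>
       int (card (irr_classes R)) = \<delta> \<and>
       (\<forall>C\<in>irr_classes R. essential_class R C))"
proof -
  let ?S = "set_pmf \<mu>" and ?S' = "set_pmf \<mu>'"
  have two_sided: "two_sided ?S" "two_sided ?S'"
    using pos neg pos' neg' by (auto simp: two_sided_def)
  have ne: "?S \<noteq> {}" "?S' \<noteq> {}" using pos pos' by auto
  have d_pos: "0 < d" "0 < d'" using two_sided two_sided_Gcd_pos d d' by auto
  have R_eq: "R = osc_reach ?S ?S'"
    unfolding R by (rule oscillating_steps.leads_to_eq_osc_reach[OF walk])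
  have 1: "(\<forall>x. x \<in> T \<longrightarrow> transient R x \<and>
          irr_class R x = (x +o {d' * k |k. True}) \<inter> {y. D \<le> ereal (of_int y)}) \<and>
       (\<forall>x. x \<notin> T \<longrightarrow> essential R x \<and>
          irr_class R x = ((x mod \<delta>) +o {\<delta> * k |k. True}) - T)"
    if less: "D < ereal (of_int d')"
      and T: "T = {k::int. D \<le> ereal (of_int k) \<and> k \<le> d' - 1} + {d' * k |k. k \<ge> 0}" for T
  proof -
    obtain m where m: "D = ereal (of_int m)" "m \<in> ?S" "\<forall>s\<in>?S. s \<le> m"
      using ext_max_less[OF ne(1)] less unfolding D by blast
    have "0 \<le> m" using pos m(3) by force
    \<comment> \<open>Membership in the exceptional set becomes the residue condition under which
      the graph results are stated.\<close>
    then have T_eq: "T = {x. 0 \<le> x \<and> m \<le> x mod d'}"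
      using residue_set_nonneg[of m d'] d_pos unfolding T m(1) by simp
    have "m < Gcd ?S'" using less m(1) d' by simp
    note high = osc_reach_high_residue[OF two_sided m(3,2) this]
      and low = osc_reach_low_residue[OF two_sided m(3,2) this]
    show ?thesis
      unfolding T_eq elt_set_plus_mod_multiples
      unfolding elt_set_plus_multiples transient_def R_eq
      using high low m(1) by (auto simp: d d' \<delta>)
  qed
  have 2: "(\<forall>x. x \<in> T \<longrightarrow> transient R x \<and>
          irr_class R x = (x +o {d * k |k. True}) \<inter> {y. ereal (of_int y) \<le> D' - 1}) \<and>
       (\<forall>x. x \<notin> T \<longrightarrow> essential R x \<and>
          irr_class R x = ((x mod \<delta>) +o {\<delta> * k |k. True}) - T)"
    if less: "D' > ereal (of_int (- d))"
      and T: "T = {k::int. - d \<le> k \<and> ereal (of_int k) \<le> D' - 1} + {d * k |k. k \<le> 0}" for T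
  proof -
    obtain m where m: "D' = ereal (of_int m)" "m \<in> ?S'" "\<forall>s\<in>?S'. m \<le> s"
      using ext_min_greater[OF ne(2)] less unfolding D' by blast
    \<comment> \<open>As \<open>D'\<close> is finite here, the extended-real bound
      \<open>D' - 1\<close> is the integer \<open>m - 1\<close>.\<close>
    have "D' - 1 = ereal (of_int (m - 1))"
      unfolding m(1) one_ereal_def by simp
    then have D1: "ereal (of_int k) \<le> D' - 1 \<longleftrightarrow> k \<le> m - 1" for k
      by (simp only: ereal_less_eq of_int_le_iff)
    have "m \<le> 0" using neg' m(3) by force
    then have T_eq: "T = {x. x < 0 \<and> - m \<le> (- 1 - x) mod d}"
      using residue_set_neg[of m d] d_pos unfolding T D1 by simp
    have "- Gcd ?S < m" using less m(1) d by simp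
    note high = osc_reach_high_residue_reflected[OF two_sided m(3,2) this]
      and low = osc_reach_low_residue_reflected[OF two_sided m(3,2) this]
    show ?thesis
      unfolding T_eq elt_set_plus_mod_multiples
      unfolding elt_set_plus_multiples transient_def R_eq D1
      using high low by (auto simp: d d' \<delta>)
  qed
  have 3: "irr_classes R = {r +o {\<delta> * k |k. True} |r. 0 \<le> r \<and> r < \<delta>} \<and>
       int (card (irr_classes R)) = \<delta> \<and> (\<forall>C\<in>irr_classes R. essential_class R C)"
    if le: "D \<ge> ereal (of_int d')" "D' \<le> ereal (of_int (- d))"
  proof -
    obtain s where s: "s \<in> ?S" "d' \<le> s" using ext_max_ge[OF ne(1)] le(1) unfolding D by blast
    obtain t where t: "t \<in> ?S'" "t \<le> - d" using ext_min_le[OF ne(2)] le(2) unfolding D' by blast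
    have "R x y \<longleftrightarrow> \<delta> dvd y - x" for x y
      using osc_reach_iff[OF two_sided s(1) _ t(1)] s(2) t(2) unfolding R_eq d d' \<delta> by simp
    moreover have "\<delta> > 0" using d_pos \<delta> by simp
    ultimately show ?thesis using irr_classes_eq_cosets[of \<delta> R] by simp
  qed
  show ?thesis
    unfolding Let_def
    by (rule conjI[OF impI conjI[OF impI impI]], erule 1[OF _ refl], erule 2[OF _ refl],
      erule conjE, rule 3)
qed

end
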